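(* Let $C$ be an $n\times n$ non-singular matrix and suppose $A = C-\alpha\,\mathbf u\mathbf u^T$ is singular with $A\mathbf u = A^T\mathbf u=\mathbf 0$, where $\alpha$ is a scalar and $\mathbf u$ is an $n$-vector. Partition $$A=\begin{bmatrix}A_{11}&\mathbf a_{12}\\ \mathbf a_{21}^T&a_{nn}\end{bmatrix},\qquad \mathbf u=\begin{bmatrix}\mathbf u_1\\ u_n\end{bmatrix},$$ and assume $\mathbf u^T\mathbf u=1$ and $u_n>0$. Then: (a) The right and left nullspaces of $A$ are $\mathrm{nullsp}(A)=\mathrm{nullsp}(A^T)=\mathrm{span}(\mathbf u)$, and the Moore-Penrose pseudo-inverse of $A$ is $$A^{\dagger}=B:=C^{-1}-\mathbf u\mathbf u^T/\alpha .$$ (b) $A_{11}^{-1}$ exists and can be written in terms of $A^\dagger=B=\begin{bmatrix}B_{11}&\mathbf b_{12}\\ \mathbf b_{21}^T&b_{nn}\end{bmatrix}$ as $$A_{11}^{-1}=\begin{bmatrix}I_{n-1},&-\mathbf u_1/u_n\end{bmatrix}B\begin{bmatrix}I_{n-1}\\-\mathbf u_1^T/u_n\end{bmatrix} = B_{11}-\frac1{u_n}\mathbf u_1\mathbf b_{21}^T-\frac1{u_n}\mathbf b_{12}\mathbf u_1^T+\frac{b_{nn}}{u_n^2}\mathbf u_1\mathbf u_1^T .$$ (c) $A$ and $B=A^\dagger$ can be written in terms of $A_{11}$ and $\mathbf u$ as $$A=\begin{bmatrix}A_{11}&-\frac1{u_n}A_{11}\mathbf u_1\\ -\frac1{u_n}\mathbf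 u_1^TA_{11}&\frac1{u_n^2}\mathbf u_1^TA_{11}\mathbf u_1\end{bmatrix} =\begin{bmatrix}I_{n-1}\\-\frac1{u_n}\mathbf u_1^T\end{bmatrix}A_{11}\begin{bmatrix}I_{n-1},&-\frac1{u_n}\mathbf u_1\end{bmatrix},$$ $$B=\begin{bmatrix}B_{11}&\mathbf b_{12}\\ \mathbf b_{21}^T&b_{nn}\end{bmatrix} =\begin{bmatrix}I_{n-1}-\mathbf u_1\mathbf u_1^T\\-u_n\mathbf u_1^T\end{bmatrix}A_{11}^{-1}\begin{bmatrix}I_{n-1}-\mathbf u_1\mathbf u_1^T,&-u_n\mathbf u_1\end{bmatrix},$$ where the individual blocks of $B$ are $$\begin{aligned} B_{11}&=A_{11}^{-1}-\mathbf u_1\mathbf t^T-\mathbf w\mathbf u_1^T+(\mathbf u_1^T\mathbf w)\,\mathbf u_1\mathbf u_1^T,\\ \mathbf b_{12}&=u_n(\mathbf u_1^T\mathbf w)\,\mathbf u_1-u_n\mathbf w,\\ \mathbf b_{21}^T&=u_n(\mathbf u_1^T\mathbf w)\,\mathbf u_1^T-u_n\mathbf t^T,\\ b_{nn}&=u_n^2(\mathbf u_1^T\mathbf w), \end{aligned}$$ with $\mathbf w=A_{11}^{-1}\mathbf u_1$ and $\mathbf t^T=\mathbf u_1^TA_{11}^{-1}$.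
   Context: All matrices and vectors are real, and $n\ge 2$. In the partitions, $A_{11}$ and $B_{11}$ are the leading $(n-1)\times(n-1)$ principal submatrices, $\mathbf a_{12},\mathbf a_{21},\mathbf b_{12},\mathbf b_{21},\mathbf u_1$ are column vectors of length $n-1$, and $a_{nn},b_{nn},u_n$ are scalars. $I_{n-1}$ is the identity matrix of order $n-1$, and $\dagger$ denotes the Moore-Penrose pseudo-inverse. *)

theory Defs
  imports
    "Jordan_Normal_Form.Matrix_Kernel"
    "Jordan_Normal_Form.Gauss_Jordan_Elimination"
begin

definition mat_of_col :: "'a vec \<Rightarrow> 'a mat" where
  "mat_of_col v = transpose_mat (mat_of_row v)"

definition mat_of_scalar :: "'a \<Rightarrow> 'a mat" where
  "mat_of_scalar x = mat 1 1 (\<lambda>_. x)"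

definition append_cols :: "'a :: zero mat \<Rightarrow> 'a mat \<Rightarrow> 'a mat" (infixr \<open>@\<^sub>c\<close> 65) where
  "A @\<^sub>c B = four_block_mat A B (0\<^sub>m 0 (dim_col A)) (0\<^sub>m 0 (dim_col B))"

lemma append_cols_carrier [simp, intro]:
  "A \<in> carrier_mat nr nc1 \<Longrightarrow> B \<in> carrier_mat nr nc2 \<Longrightarrow> A @\<^sub>c B \<in> carrier_mat nr (nc1 + nc2)"
  unfolding append_cols_def by auto

abbreviation span_vec :: "nat \<Rightarrow> real vec set \<Rightarrow> real vec set" where
  "span_vec n \<equiv> LinearCombinations.module.span class_ring (module_vec TYPE(real) n)"

text \<open>An unspecified value if the matrix is singular.\<close>

definition mat_inv :: "'a :: field mat \<Rightarrow> 'a mat" where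
  "mat_inv A = the (mat_inverse A)"

lemma mat_inv:
  assumes "A \<in> carrier_mat n n" "invertible_mat A"
  shows "mat_inv A \<in> carrier_mat n n" "A * mat_inv A = 1\<^sub>m n" "mat_inv A * A = 1\<^sub>m n"
proof -
  from assms obtain X where X: "A * X = 1\<^sub>m n" "X * A = 1\<^sub>m (dim_row X)"
    unfolding invertible_mat_def inverts_mat_def by auto
  have "dim_col X = n"
    using arg_cong[OF X(1), of dim_col] by simp
  moreover have "dim_row X = n"
    using arg_cong[OF X(2), of dim_col] assms(1) by simp
  ultimately have "A \<in> Units (ring_mat TYPE('a) n ())"
    using X assms(1) unfolding Units_def ring_mat_simps by (auto intro!: bexI[of _ X])
  then obtain Y where "mat_inverse A = Some Y"
    using mat_inverse(1)[OF assms(1), of "()"] by (cases "mat_inverse A") auto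
  then show "mat_inv A \<in> carrier_mat n n" "A * mat_inv A = 1\<^sub>m n" "mat_inv A * A = 1\<^sub>m n"
    using mat_inverse(2)[OF assms(1)] by (auto simp: mat_inv_def)
qed

text \<open>The four Penrose conditions; over the reals the adjoint is the transpose.\<close>

definition is_moore_penrose_inverse :: "real mat \<Rightarrow> real mat \<Rightarrow> bool" where
  "is_moore_penrose_inverse A X \<longleftrightarrow>
     X \<in> carrier_mat (dim_col A) (dim_row A) \<and>
     A * X * A = A \<and>
     X * A * X = X \<and>
     transpose_mat (A * X) = A * X \<and>
     transpose_mat (X * A) = X * A"

definition pseudo_inverse :: "real mat \<Rightarrow> real mat" where
  "pseudo_inverse A = (THE X. is_moore_penrose_inverse A X)"

lemma moore_penrose_inverse_unique:
  assumes "is_moore_penrose_inverse A X" "is_moore_penrose_inverse A Y"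
  shows "X = Y"
proof -
  define m k where "m = dim_row A" and "k = dim_col A"
  have A: "A \<in> carrier_mat m k" by (auto simp: m_def k_def)
  have X: "X \<in> carrier_mat k m" and Y: "Y \<in> carrier_mat k m"
    using assms by (auto simp: is_moore_penrose_inverse_def m_def k_def)
  note c = A X Y
  have AX: "A * X \<in> carrier_mat m m" and AY: "A * Y \<in> carrier_mat m m"
    and XA: "X * A \<in> carrier_mat k k" and YA: "Y * A \<in> carrier_mat k k"
    using c by auto
  have x: "A * X * A = A" "X * A * X = X" "transpose_mat (A * X) = A * X"
      "transpose_mat (X * A) = X * A"
    and y: "A * Y * A = A" "Y * A * Y = Y" "transpose_mat (A * Y) = A * Y"
      "transpose_mat (Y * A) = Y * A"
    using assms by (auto simp: is_moore_penrose_inverse_def)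
  have 1: "A * Y = A * X"
  proof -
    have e: "(A * X) * (A * Y) = A * Y"
      using x(1) assoc_mult_mat[OF AX A Y] by simp
    have "A * X = (A * Y) * (A * X)"
      using y(1) assoc_mult_mat[OF AY A X] by simp
    also have "\<dots> = transpose_mat ((A * X) * (A * Y))"
      using transpose_mult[OF AX AY] x(3) y(3) by simp
    also have "\<dots> = A * Y" using e y(3) by simp
    finally show ?thesis ..
  qed
  have 2: "Y * A = X * A"
  proof -
    have e: "(X * A) * (Y * A) = X * A"
      using y(1) assoc_mult_mat[OF X A YA] assoc_mult_mat[OF A Y A] by simp
    have "Y * A = (Y * A) * (X * A)"
      using x(1) assoc_mult_mat[OF Y A XA] assoc_mult_mat[OF A X A] by simp
    also have "\<dots> = transpose_mat ((X * A) * (Y * A))"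
      using transpose_mult[OF XA YA] x(4) y(4) by simp
    also have "\<dots> = X * A" using e x(4) by simp
    finally show ?thesis .
  qed
  have "X = X * (A * X)" using x(2) assoc_mult_mat[OF X A X] by simp
  also have "\<dots> = X * A * Y" using 1 assoc_mult_mat[OF X A Y] by simp
  also have "\<dots> = Y" using 2 y(2) by simp
  finally show ?thesis .
qed

lemma pseudo_inverse_eqI:
  "is_moore_penrose_inverse A X \<Longrightarrow> pseudo_inverse A = X"
  unfolding pseudo_inverse_def using moore_penrose_inverse_unique by blast

end

theory Submission
  imports Defs
begin

text \<open>
  Write O = u u^T and R = I - O, the orthogonal projector onto the hyperplane H = u^\<perp>. Since
  A u = A^T u = 0 and u is a unit vector, u is a left and right eigenvector of C = A + \<alpha> O with
  eigenvalue \<alpha>, hence also of C^{-1} with eigenvalue 1/\<alpha>. So B = C^{-1} - O/\<alpha> kills u from both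
  sides, and A B = A C^{-1} = (C - \<alpha> O) C^{-1} = R, and likewise B A = R. Both the Penrose conditions
  and the null spaces follow from A B = B A = R: A and B annihilate u, so multiplying by R does not
  change them, and A x = 0 forces R x = 0. The scalar \<alpha> is nonzero because A is singular and C is not.

  For the remaining parts put Q = [I, -u_1/u_n] and P = Q^T (perp_rows and perp_cols below).
  The columns of P form a basis of H, and Q u = 0. Reading A u = 0 and A^T u = 0 block by block shows
  that A is determined by its leading block: A = P A_11 Q. With E = [I, 0], which satisfies E P = I,
  this gives
    A_11 Q B P = E P A_11 Q B P = E A B P = E R P = E P = I,
  so A_11^{-1} = Q B P (lemma compressed_inverse). Conversely, P E and the identity differ by a
  matrix whose rows are multiples of u^T, so P E R = R and, by transposition, R E^T Q = R; hence
  (R E^T) (Q B P) (E R) = R B R = B (lemma expanded_inverse). Here E R = [I - u_1 u_1^T, -u_n u_1]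
  is the factor in the statement, and the formulas for the individual blocks come from multiplying
  these products out.
\<close>

section \<open>Rows, columns and rank-one matrices\<close>

abbreviation outer :: "real vec \<Rightarrow> real vec \<Rightarrow> real mat" where
  "outer u v \<equiv> mat_of_col u * mat_of_row v"

lemma mat_of_col_carrier [simp]:
  "v \<in> carrier_vec n \<Longrightarrow> mat_of_col v \<in> carrier_mat n 1"
  "v \<in> carrier_vec n \<Longrightarrow> mat_of_col v \<in> carrier_mat n (Suc 0)"
  by (auto simp: mat_of_col_def)

lemma mat_of_col_dim [simp]: "dim_row (mat_of_col v) = dim_vec v" "dim_col (mat_of_col v) = 1"
  by (auto simp: mat_of_col_def)

lemma mat_of_col_index [simp]: "i < dim_vec v \<Longrightarrow> mat_of_col v $$ (i, 0) = v $ i"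
  by (auto simp: mat_of_col_def)

lemma col_mat_of_col [simp]: "col (mat_of_col v) 0 = v"
  by (auto simp: mat_of_col_def)

lemma row_mat_of_col: "i < dim_vec v \<Longrightarrow> row (mat_of_col v) i = vec 1 (\<lambda>_. v $ i)"
  by (auto intro!: eq_vecI)

lemma col_mat_of_row: "i < dim_vec v \<Longrightarrow> col (mat_of_row v) i = vec 1 (\<lambda>_. v $ i)"
  by (auto intro!: eq_vecI)

lemma row_mat_of_col_scalar_col_mat_of_row [simp]:
  fixes u v :: "real vec"
  shows "i < dim_vec u \<Longrightarrow> j < dim_vec v \<Longrightarrow>
    row (mat_of_col u) i \<bullet> col (mat_of_row v) j = u $ i * v $ j"
  by (simp add: row_mat_of_col col_mat_of_row scalar_prod_def)

lemma outer_carrier [simp]: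
  "u \<in> carrier_vec m \<Longrightarrow> v \<in> carrier_vec n \<Longrightarrow> outer u v \<in> carrier_mat m n"
  by auto

lemma outer_index [simp]:
  "i < dim_vec u \<Longrightarrow> j < dim_vec v \<Longrightarrow> outer u v $$ (i, j) = u $ i * v $ j"
  by simp

lemma mult_mat_of_col:
  "M \<in> carrier_mat m n \<Longrightarrow> u \<in> carrier_vec n \<Longrightarrow> M * mat_of_col u = mat_of_col (M *\<^sub>v u)"
  by (rule eq_matI) auto

lemma mat_of_row_mult:
  fixes u :: "real vec"
  shows "M \<in> carrier_mat n m \<Longrightarrow> u \<in> carrier_vec n \<Longrightarrow>
    mat_of_row u * M = mat_of_row (transpose_mat M *\<^sub>v u)"
  by (rule eq_matI) (auto simp: comm_scalar_prod[of _ n])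

lemma row_times_col:
  "u \<in> carrier_vec n \<Longrightarrow> v \<in> carrier_vec n \<Longrightarrow>
    mat_of_row u * mat_of_col v = mat_of_scalar (u \<bullet> v)"
  by (rule eq_matI) (auto simp: mat_of_scalar_def)

lemma mult_outer:
  assumes "M \<in> carrier_mat m n" "u \<in> carrier_vec n" "v \<in> carrier_vec k"
  shows "M * outer u v = outer (M *\<^sub>v u) v"
  using assms by (simp add: mult_mat_of_col assoc_mult_mat[of _ m n _ 1 _ k, symmetric])

lemma outer_mult:
  assumes "M \<in> carrier_mat n m" "v \<in> carrier_vec n" "u \<in> carrier_vec k"
  shows "outer u v * M = outer u (transpose_mat M *\<^sub>v v)"
  using assms by (simp add: mat_of_row_mult assoc_mult_mat[of _ k 1 _ n _ m])

lemma outer_mult_vec: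
  assumes "u \<in> carrier_vec m" "v \<in> carrier_vec n" "x \<in> carrier_vec n"
  shows "outer u v *\<^sub>v x = (v \<bullet> x) \<cdot>\<^sub>v u"
proof (rule eq_vecI)
  fix i assume "i < dim_vec ((v \<bullet> x) \<cdot>\<^sub>v u)"
  then have "row (outer u v) i = u $ i \<cdot>\<^sub>v v"
    using assms by (auto intro!: eq_vecI)
  then show "(outer u v *\<^sub>v x) $ i = ((v \<bullet> x) \<cdot>\<^sub>v u) $ i"
    using assms \<open>i < _\<close> by simp
qed (use assms in auto)

lemma transpose_outer: "transpose_mat (outer u v) = outer v u"
  by (rule eq_matI) auto

lemma span_singleton:
  assumes "u \<in> carrier_vec n"
  shows "span_vec n {u} = range (\<lambda>c. c \<cdot>\<^sub>v u)"
proof -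
  interpret vec_space "TYPE(real)" n .
  show ?thesis
    using assms by (subst finite_span) (auto simp: lincomb_def)
qed


lemma mat_of_col_eq_iff [simp]: "mat_of_col v = mat_of_col w \<longleftrightarrow> v = w"
  by (metis col_mat_of_col)

lemma mat_of_row_eq_iff [simp]: "mat_of_row v = mat_of_row w \<longleftrightarrow> v = w"
  by (metis row_mat_of_row)

lemma mat_of_scalar_carrier [simp]:
  "mat_of_scalar x \<in> carrier_mat 1 1" "mat_of_scalar x \<in> carrier_mat (Suc 0) (Suc 0)"
  by (auto simp: mat_of_scalar_def)

lemma mat_of_scalar_eq_iff [simp]: "mat_of_scalar x = mat_of_scalar y \<longleftrightarrow> x = y"
proof
  assume "mat_of_scalar x = mat_of_scalar y"
  then have "mat_of_scalar x $$ (0, 0) = mat_of_scalar y $$ (0, 0)" by simp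
  then show "x = y" by (simp add: mat_of_scalar_def)
qed simp

lemma smult_mat_of_col: "c \<cdot>\<^sub>m mat_of_col v = mat_of_col (c \<cdot>\<^sub>v v)"
  by (rule eq_matI) auto

lemma smult_mat_of_row: "c \<cdot>\<^sub>m mat_of_row v = mat_of_row (c \<cdot>\<^sub>v v)"
  by (rule eq_matI) auto

lemma smult_mat_of_scalar: "c \<cdot>\<^sub>m mat_of_scalar x = mat_of_scalar (c * x)"
  by (rule eq_matI) (auto simp: mat_of_scalar_def)

lemma transpose_mat_of_col [simp]: "transpose_mat (mat_of_col v) = mat_of_row v"
  by (simp add: mat_of_col_def)

lemma transpose_mat_of_row [simp]: "transpose_mat (mat_of_row v) = mat_of_col v"
  by (simp add: mat_of_col_def)

lemma transpose_mat_of_scalar [simp]: "transpose_mat (mat_of_scalar x) = mat_of_scalar x"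
  by (rule eq_matI) (auto simp: mat_of_scalar_def)

lemma transpose_smult: "transpose_mat (c \<cdot>\<^sub>m M) = c \<cdot>\<^sub>m transpose_mat M"
  by (rule eq_matI) auto

lemma smult_mat_mult_vec:
  fixes M :: "real mat"
  assumes "M \<in> carrier_mat m n" "x \<in> carrier_vec n"
  shows "(c \<cdot>\<^sub>m M) *\<^sub>v x = c \<cdot>\<^sub>v (M *\<^sub>v x)"
  using assms by (intro eq_vecI) auto

lemma mat_of_col_mult_vec1:
  fixes v :: "real vec"
  shows "mat_of_col v *\<^sub>v vec 1 (\<lambda>_. x) = x \<cdot>\<^sub>v v"
  by (rule eq_vecI) (auto simp: row_mat_of_col scalar_prod_def)

lemma mat_of_row_mult_vec: "mat_of_row v *\<^sub>v w = vec 1 (\<lambda>_. v \<bullet> w)"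
  by (rule eq_vecI) auto

lemma mat_of_scalar_mult_vec1:
  fixes a :: real
  shows "mat_of_scalar a *\<^sub>v vec 1 (\<lambda>_. x) = vec 1 (\<lambda>_. a * x)"
  by (rule eq_vecI) (auto simp: mat_of_scalar_def scalar_prod_def)

section \<open>Products of block matrices\<close>

lemma four_block_mat_inject:
  assumes "A \<in> carrier_mat m k" "B \<in> carrier_mat m l" "C \<in> carrier_mat p k" "D \<in> carrier_mat p l"
    and "A' \<in> carrier_mat m k" "B' \<in> carrier_mat m l" "C' \<in> carrier_mat p k" "D' \<in> carrier_mat p l"
    and eq: "four_block_mat A B C D = four_block_mat A' B' C' D'"
  shows "A = A'" "B = B'" "C = C'" "D = D'"
proof -
  have e: "four_block_mat A B C D $$ (i, j) = four_block_mat A' B' C' D' $$ (i, j)" for i j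
    using eq by simp
  show "A = A'"
  proof (rule eq_matI)
    fix i j assume "i < dim_row A'" "j < dim_col A'"
    then show "A $$ (i, j) = A' $$ (i, j)" using e[of i j] assms(1-8) by auto
  qed (use assms in auto)
  show "B = B'"
  proof (rule eq_matI)
    fix i j assume "i < dim_row B'" "j < dim_col B'"
    then show "B $$ (i, j) = B' $$ (i, j)" using e[of i "j + k"] assms(1-8) by auto
  qed (use assms in auto)
  show "C = C'"
  proof (rule eq_matI)
    fix i j assume "i < dim_row C'" "j < dim_col C'"
    then show "C $$ (i, j) = C' $$ (i, j)" using e[of "i + m" j] assms(1-8) by auto
  qed (use assms in auto)
  show "D = D'"
  proof (rule eq_matI)
    fix i j assume "i < dim_row D'" "j < dim_col D'"
    then show "D $$ (i, j) = D' $$ (i, j)" using e[of "i + m" "j + k"] assms(1-8) by auto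
  qed (use assms in auto)
qed

lemma append_cols_mult_append_rows:
  fixes A :: "real mat"
  assumes "A \<in> carrier_mat m k" "B \<in> carrier_mat m l" "C \<in> carrier_mat k p" "D \<in> carrier_mat l p"
  shows "(A @\<^sub>c B) * (C @\<^sub>r D) = A * C + B * D"
proof -
  have "(A @\<^sub>c B) * (C @\<^sub>r D) =
      four_block_mat (A * C + B * D) (A * 0\<^sub>m k 0 + B * 0\<^sub>m l 0)
        (0\<^sub>m 0 k * C + 0\<^sub>m 0 l * D) (0\<^sub>m 0 k * 0\<^sub>m k 0 + 0\<^sub>m 0 l * 0\<^sub>m l 0)"
    using assms unfolding append_cols_def append_rows_def
    by (subst mult_four_block_mat[of _ m k _ l _ 0 _ _ p _ 0]) auto
  also have "\<dots> = A * C + B * D"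
    using assms by (intro eq_matI) auto
  finally show ?thesis .
qed

lemma append_rows_mult_append_cols:
  fixes A :: "real mat"
  assumes "A \<in> carrier_mat m k" "B \<in> carrier_mat l k" "C \<in> carrier_mat k p" "D \<in> carrier_mat k q"
  shows "(A @\<^sub>r B) * (C @\<^sub>c D) = four_block_mat (A * C) (A * D) (B * C) (B * D)"
proof -
  have "(A @\<^sub>r B) * (C @\<^sub>c D) =
      four_block_mat (A * C + 0\<^sub>m m 0 * 0\<^sub>m 0 p) (A * D + 0\<^sub>m m 0 * 0\<^sub>m 0 q)
        (B * C + 0\<^sub>m l 0 * 0\<^sub>m 0 p) (B * D + 0\<^sub>m l 0 * 0\<^sub>m 0 q)"
    using assms unfolding append_cols_def append_rows_def
    by (subst mult_four_block_mat[of _ m k _ 0 _ l _ _ p _ q]) auto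
  also have "\<dots> = four_block_mat (A * C) (A * D) (B * C) (B * D)"
    using assms by simp
  finally show ?thesis .
qed

lemma append_rows_mult:
  fixes A :: "real mat"
  assumes "A \<in> carrier_mat m k" "B \<in> carrier_mat l k" "M \<in> carrier_mat k p"
  shows "(A @\<^sub>r B) * M = (A * M) @\<^sub>r (B * M)"
proof (rule eq_matI)
  fix i j assume ij: "i < dim_row ((A * M) @\<^sub>r (B * M))" "j < dim_col ((A * M) @\<^sub>r (B * M))"
  then have "row (A @\<^sub>r B) i = (if i < m then row A i else row B (i - m))"
    using assms by (auto simp: append_rows_def intro!: eq_vecI)
  then show "((A @\<^sub>r B) * M) $$ (i, j) = ((A * M) @\<^sub>r (B * M)) $$ (i, j)"
    using assms ij by (auto simp: append_rows_def)
qed (use assms in \<open>auto simp: append_rows_def\<close>)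

lemma four_block_mat_mult_append_rows:
  fixes A :: "real mat"
  assumes "A \<in> carrier_mat m k" "B \<in> carrier_mat m l" "C \<in> carrier_mat p k" "D \<in> carrier_mat p l"
    and "Z \<in> carrier_mat k q" "W \<in> carrier_mat l q"
  shows "four_block_mat A B C D * (Z @\<^sub>r W) = (A * Z + B * W) @\<^sub>r (C * Z + D * W)"
proof -
  have "four_block_mat A B C D * (Z @\<^sub>r W) =
      four_block_mat (A * Z + B * W) (A * 0\<^sub>m k 0 + B * 0\<^sub>m l 0)
        (C * Z + D * W) (C * 0\<^sub>m k 0 + D * 0\<^sub>m l 0)"
    using assms unfolding append_rows_def
    by (subst mult_four_block_mat[of _ m k _ l _ p _ _ q _ 0]) auto
  also have "\<dots> = (A * Z + B * W) @\<^sub>r (C * Z + D * W)"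
    using assms unfolding append_rows_def by (intro cong_four_block_mat) auto
  finally show ?thesis .
qed

lemma transpose_append_rows:
  assumes "A \<in> carrier_mat m k" "B \<in> carrier_mat l k"
  shows "transpose_mat (A @\<^sub>r B) = transpose_mat A @\<^sub>c transpose_mat B"
  using assms unfolding append_rows_def append_cols_def
  by (subst transpose_four_block_mat[of _ m k _ 0 _ l]) auto

lemma append_cols_mult_vec:
  fixes A :: "real mat"
  assumes "A \<in> carrier_mat m k" "B \<in> carrier_mat m l" "x \<in> carrier_vec k" "y \<in> carrier_vec l"
  shows "(A @\<^sub>c B) *\<^sub>v (x @\<^sub>v y) = A *\<^sub>v x + B *\<^sub>v y"
  using assms unfolding append_cols_def
  by (subst four_block_mat_mult_vec[of _ m k _ l _ 0]) (auto intro!: eq_vecI)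


section \<open>Pseudo-inverse of a matrix with a known null vector\<close>

text \<open>
  The vector u is an eigenvector of C = A + \<alpha> u u^T and of its transpose for the eigenvalue \<alpha>, so it is
  one of X = C^{-1} and its transpose for 1/\<alpha>. Subtracting u u^T/\<alpha> replaces this eigenvalue by 0.
\<close>

lemma deflation_pseudo_inverse:
  fixes A X :: "real mat"
  assumes A: "A \<in> carrier_mat n n" and X: "X \<in> carrier_mat n n"
    and u: "u \<in> carrier_vec n" "u \<bullet> u = 1" and \<alpha>: "\<alpha> \<noteq> 0"
    and null: "A *\<^sub>v u = 0\<^sub>v n" "transpose_mat A *\<^sub>v u = 0\<^sub>v n"
    and CX: "(A + \<alpha> \<cdot>\<^sub>m outer u u) * X = 1\<^sub>m n" and XC: "X * (A + \<alpha> \<cdot>\<^sub>m outer u u) = 1\<^sub>m n"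
  defines "B \<equiv> X - (1 / \<alpha>) \<cdot>\<^sub>m outer u u"
  shows "A * B = 1\<^sub>m n - outer u u" "B * A = 1\<^sub>m n - outer u u"
    "B *\<^sub>v u = 0\<^sub>v n" "transpose_mat B *\<^sub>v u = 0\<^sub>v n"
proof -
  define C where "C = A + \<alpha> \<cdot>\<^sub>m outer u u"
  note c = A X u(1)
  have C: "C \<in> carrier_mat n n" using c by (auto simp: C_def)
  have CT: "transpose_mat C = transpose_mat A + \<alpha> \<cdot>\<^sub>m outer u u"
    unfolding C_def using c by (subst transpose_add[of _ n n]) (auto simp: transpose_smult transpose_outer)
  have ou: "(\<alpha> \<cdot>\<^sub>m outer u u) *\<^sub>v u = \<alpha> \<cdot>\<^sub>v u"  for \<alpha>
    using u outer_mult_vec[of u n u n u] by (subst smult_mat_mult_vec[of _ n n]) auto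
  have Cu: "C *\<^sub>v u = \<alpha> \<cdot>\<^sub>v u" "transpose_mat C *\<^sub>v u = \<alpha> \<cdot>\<^sub>v u"
    unfolding CT unfolding C_def using c null ou
    by (auto simp: add_mult_distrib_mat_vec[of _ n n])
  \<comment> \<open>Stated for a one-sided inverse Y of D, to be used for C and for its transpose.\<close>
  have eig: "Y *\<^sub>v u = (1 / \<alpha>) \<cdot>\<^sub>v u"
    if Y: "Y \<in> carrier_mat n n" and D: "D \<in> carrier_mat n n" "Y * D = 1\<^sub>m n"
      and e: "D *\<^sub>v u = \<alpha> \<cdot>\<^sub>v u" for Y D :: "real mat"
  proof -
    have "u = Y *\<^sub>v (D *\<^sub>v u)"
      using assoc_mult_mat_vec[OF Y D(1) u(1)] D(2) u(1) by simp
    also have "\<dots> = \<alpha> \<cdot>\<^sub>v (Y *\<^sub>v u)" using e mult_mat_vec[OF Y u(1)] by simp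
    finally have "(1 / \<alpha>) \<cdot>\<^sub>v u = (1 / \<alpha>) \<cdot>\<^sub>v (\<alpha> \<cdot>\<^sub>v (Y *\<^sub>v u))" by simp
    then show ?thesis using \<alpha> by (simp add: smult_smult_assoc)
  qed
  have XT: "transpose_mat X * transpose_mat C = 1\<^sub>m n"
    using transpose_mult[OF C X] CX by (simp add: C_def)
  have Xu: "X *\<^sub>v u = (1 / \<alpha>) \<cdot>\<^sub>v u" "transpose_mat X *\<^sub>v u = (1 / \<alpha>) \<cdot>\<^sub>v u"
    using eig[OF X C _ Cu(1)] eig[OF _ _ XT Cu(2)] XC C X by (auto simp: C_def)
  have BT: "transpose_mat B = transpose_mat X - (1 / \<alpha>) \<cdot>\<^sub>m outer u u"
    unfolding B_def using c by (subst transpose_minus[of _ n n]) (auto simp: transpose_smult transpose_outer)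
  show "B *\<^sub>v u = 0\<^sub>v n" "transpose_mat B *\<^sub>v u = 0\<^sub>v n"
    unfolding BT unfolding B_def using c Xu ou
    by (auto simp: minus_mult_distrib_mat_vec[of _ n n])
  have O: "outer u u \<in> carrier_mat n n" using u by simp
  have 1: "A = C - \<alpha> \<cdot>\<^sub>m outer u u"
    unfolding C_def using c by (intro eq_matI) auto
  have "A * B = A * X - (1 / \<alpha>) \<cdot>\<^sub>m (A * outer u u)"
    unfolding B_def using c O by (simp add: mult_minus_distrib_mat[of _ n n] mult_smult_distrib[of _ n n _ n])
  also have "A * outer u u = 0\<^sub>m n n"
    using c null by (subst mult_outer[of _ n n]) (auto intro!: eq_matI)
  also have "A * X = C * X - \<alpha> \<cdot>\<^sub>m (outer u u * X)"
    using 1 C X O by (simp add: minus_mult_distrib_mat[of _ n n] mult_smult_assoc_mat[of _ n n _ n])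
  also have "outer u u * X = outer u ((1 / \<alpha>) \<cdot>\<^sub>v u)"
    using outer_mult[OF X u(1) u(1)] Xu by simp
  also have "C * X = 1\<^sub>m n" using CX by (simp add: C_def)
  finally show "A * B = 1\<^sub>m n - outer u u" 
    using u \<alpha> by (intro eq_matI) auto
  have "B * A = X * A - (1 / \<alpha>) \<cdot>\<^sub>m (outer u u * A)"
    unfolding B_def using c O by (simp add: minus_mult_distrib_mat[of _ n n] mult_smult_assoc_mat[of _ n n _ n])
  also have "outer u u * A = 0\<^sub>m n n"
    using c null by (subst outer_mult[of _ n n]) (auto intro!: eq_matI)
  also have "X * A = X * C - \<alpha> \<cdot>\<^sub>m (X * outer u u)"
    using 1 C X O by (simp add: mult_minus_distrib_mat[of _ n n] mult_smult_distrib[of _ n n _ n])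
  also have "X * outer u u = outer ((1 / \<alpha>) \<cdot>\<^sub>v u) u"
    using mult_outer[OF X u(1) u(1)] Xu by simp
  also have "X * C = 1\<^sub>m n" using XC by (simp add: C_def)
  finally show "B * A = 1\<^sub>m n - outer u u" 
    using u \<alpha> by (intro eq_matI) auto
qed

text \<open>
  These two rules, based on u u^T M = u (M^T u)^T and M u u^T = (M u) u^T, are how the null vector
  enters all later computations with the projector.
\<close>

lemma projector_mult_annihilated:
  assumes "M \<in> carrier_mat n k" "u \<in> carrier_vec n" "transpose_mat M *\<^sub>v u = 0\<^sub>v k"
  shows "(1\<^sub>m n - outer u u) * M = M"
proof -
  have "(1\<^sub>m n - outer u u) * M = 1\<^sub>m n * M - outer u u * M"
    using assms by (intro minus_mult_distrib_mat) auto
  also have "\<dots> = M"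
    using assms by (subst outer_mult[of _ n k]) (auto intro!: eq_matI)
  finally show ?thesis .
qed

lemma mult_projector_annihilated:
  assumes "M \<in> carrier_mat k n" "u \<in> carrier_vec n" "M *\<^sub>v u = 0\<^sub>v k"
  shows "M * (1\<^sub>m n - outer u u) = M"
proof -
  have "M * (1\<^sub>m n - outer u u) = M * 1\<^sub>m n - M * outer u u"
    using assms by (intro mult_minus_distrib_mat) auto
  also have "\<dots> = M"
    using assms by (subst mult_outer[of _ k n]) (auto intro!: eq_matI)
  finally show ?thesis .
qed

text \<open>
  Both products are the same symmetric matrix, which gives the two symmetry conditions; multiplying
  A or B by it changes nothing, because u^T A = u^T B = 0, which gives the other two.
\<close>

lemma moore_penrose_inverseI_projector:
  assumes A: "A \<in> carrier_mat n n" and B: "B \<in> carrier_mat n n" and u: "u \<in> carrier_vec n"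
    and AB: "A * B = 1\<^sub>m n - outer u u" and BA: "B * A = 1\<^sub>m n - outer u u"
    and null: "transpose_mat A *\<^sub>v u = 0\<^sub>v n" "transpose_mat B *\<^sub>v u = 0\<^sub>v n"
  shows "is_moore_penrose_inverse A B"
proof -
  have "transpose_mat (1\<^sub>m n - outer u u) = 1\<^sub>m n - outer u u"
    using u by (subst transpose_minus[of _ n n]) (auto simp: transpose_outer)
  then show ?thesis
    using A B AB BA projector_mult_annihilated[OF A u null(1)] projector_mult_annihilated[OF B u null(2)]
    unfolding is_moore_penrose_inverse_def by auto
qed

text \<open>If A x = 0, then 0 = B A x = x - (u \<bullet> x) u exhibits x as a multiple of u.\<close>

lemma mat_kernel_eq_span_of_projector:
  assumes A: "A \<in> carrier_mat n n" and B: "B \<in> carrier_mat n n" and u: "u \<in> carrier_vec n"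
    and BA: "B * A = 1\<^sub>m n - outer u u" and null: "A *\<^sub>v u = 0\<^sub>v n"
  shows "mat_kernel A = span_vec n {u}"
proof -
  have "x \<in> range (\<lambda>c. c \<cdot>\<^sub>v u)" if x: "x \<in> carrier_vec n" "A *\<^sub>v x = 0\<^sub>v n" for x
  proof -
    have "B *\<^sub>v 0\<^sub>v n = 0\<^sub>v n" using B by (auto intro!: eq_vecI)
    then have "0\<^sub>v n = (B * A) *\<^sub>v x" using A B x by simp
    also have "\<dots> = x - (u \<bullet> x) \<cdot>\<^sub>v u"
      using u x outer_mult_vec[OF u u x(1)]
      by (simp add: BA minus_mult_distrib_mat_vec[of _ n n])
    finally have e: "0\<^sub>v n = x - (u \<bullet> x) \<cdot>\<^sub>v u" .
    have "x = (u \<bullet> x) \<cdot>\<^sub>v u"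
    proof (rule eq_vecI)
      fix i assume "i < dim_vec ((u \<bullet> x) \<cdot>\<^sub>v u)"
      then show "x $ i = ((u \<bullet> x) \<cdot>\<^sub>v u) $ i"
        using arg_cong[OF e, of "\<lambda>v. v $ i"] u x by simp
    qed (use u x in auto)
    then show ?thesis by blast
  qed
  moreover have "A *\<^sub>v (c \<cdot>\<^sub>v u) = 0\<^sub>v n" for c
    using A u null by (auto simp: mult_mat_vec)
  ultimately show ?thesis
    using u unfolding mat_kernel[OF A] span_singleton[OF u] by auto
qed

section \<open>Compressing to the hyperplane orthogonal to the null vector\<close>

text \<open>
  A left inverse E of P strips the left factor off A = P M Q, so M (Q B P) = E (A B) P; and
  A B = I - u u^T fixes the columns of P, which are orthogonal to u.
\<close>

lemma compressed_inverse:
  fixes A B M :: "real mat"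
  assumes M: "M \<in> carrier_mat m m" and P: "P \<in> carrier_mat n m" and Q: "Q \<in> carrier_mat m n"
    and E: "E \<in> carrier_mat m n" and B: "B \<in> carrier_mat n n" and u: "u \<in> carrier_vec n"
    and EP: "E * P = 1\<^sub>m m" and Pu: "transpose_mat P *\<^sub>v u = 0\<^sub>v m"
    and A: "A = P * M * Q" and AB: "A * B = 1\<^sub>m n - outer u u"
  shows "M * (Q * B * P) = 1\<^sub>m m"
proof -
  have PM: "P * M \<in> carrier_mat n m" and QB: "Q * B \<in> carrier_mat m n"
    and QBP: "Q * B * P \<in> carrier_mat m m"
    using P M Q B by auto
  have "M * (Q * B * P) = E * P * M * (Q * B * P)"
    using EP M by simp
  also have "\<dots> = E * (P * M * (Q * B * P))"
    using assoc_mult_mat[OF E P M] assoc_mult_mat[OF E PM QBP] by simp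
  also have "P * M * (Q * B * P) = A * B * P"
    using assoc_mult_mat[OF PM QB P] assoc_mult_mat[OF PM Q B] by (simp add: A)
  also have "\<dots> = P"
    using projector_mult_annihilated[OF P u Pu] by (simp add: AB)
  finally show ?thesis using EP by simp
qed

text \<open>
  Q B P still determines B: P E and F Q need not be the identity, but they act like it next to R,
  and B absorbs R on both sides.
\<close>

lemma expanded_inverse:
  fixes B :: "real mat"
  assumes P: "P \<in> carrier_mat n m" and Q: "Q \<in> carrier_mat m n"
    and E: "E \<in> carrier_mat m n" and F: "F \<in> carrier_mat n m"
    and B: "B \<in> carrier_mat n n" and R: "R \<in> carrier_mat n n"
    and FQ: "R * (F * Q) = R" and PE: "P * E * R = R"
    and RB: "R * B = B" and BR: "B * R = B"
  shows "R * F * (Q * B * P) * (E * R) = B"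
proof -
  have c: "F * Q \<in> carrier_mat n n" "P * E \<in> carrier_mat n n" "Q * B \<in> carrier_mat m n"
    "R * F \<in> carrier_mat n m" "E * R \<in> carrier_mat m n" "P * (E * R) \<in> carrier_mat n n"
    using assms by auto
  have "R * F * (Q * B * P) * (E * R) = R * F * (Q * B) * (P * (E * R))"
    using assoc_mult_mat[OF c(4) c(3) P] assoc_mult_mat[OF mult_carrier_mat[OF c(4) c(3)] P c(5)] by simp
  also have "P * (E * R) = R"
    using assoc_mult_mat[OF P E R] PE by simp
  also have "R * F * (Q * B) = R * F * Q * B"
    using assoc_mult_mat[OF c(4) Q B] by simp
  also have "R * F * Q = R"
    using assoc_mult_mat[OF R F Q] FQ by simp
  finally show ?thesis using RB BR by simp
qed

text \<open>
  For c \<noteq> 0, the columns of perp_cols m v c are a basis of the hyperplane orthogonal to the vector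
  (v, c): the j-th one is the unit vector e_j with its last entry replaced by -v_j/c. The transposed
  matrix is perp_rows m v c.
\<close>

abbreviation perp_cols :: "nat \<Rightarrow> real vec \<Rightarrow> real \<Rightarrow> real mat" where
  "perp_cols m v c \<equiv> 1\<^sub>m m @\<^sub>r (- (1 / c)) \<cdot>\<^sub>m mat_of_row v"

abbreviation perp_rows :: "nat \<Rightarrow> real vec \<Rightarrow> real \<Rightarrow> real mat" where
  "perp_rows m v c \<equiv> 1\<^sub>m m @\<^sub>c (- (1 / c)) \<cdot>\<^sub>m mat_of_col v"

lemma transpose_perp_cols:
  assumes "v \<in> carrier_vec m"
  shows "transpose_mat (perp_cols m v c) = perp_rows m v c"
  using assms by (subst transpose_append_rows[of _ m m _ 1]) (auto simp: transpose_smult)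

lemma perp_rows_mult_vec:
  assumes v: "v \<in> carrier_vec m" and c: "c \<noteq> 0"
  shows "perp_rows m v c *\<^sub>v (v @\<^sub>v vec 1 (\<lambda>_. c)) = 0\<^sub>v m"
  using assms
  by (subst append_cols_mult_vec[of _ m m _ 1])
    (auto simp: smult_mat_of_col mat_of_col_mult_vec1 smult_smult_assoc simp del: One_nat_def)

lemma bordered_blocks_of_null_vector:
  fixes M :: "real mat"
  assumes M: "M \<in> carrier_mat m m" and a: "a \<in> carrier_vec m" and b: "b \<in> carrier_vec m"
    and v: "v \<in> carrier_vec m" and c: "c \<noteq> 0"
    and null: "four_block_mat M (mat_of_col a) (mat_of_row b) (mat_of_scalar d) *\<^sub>v (v @\<^sub>v vec 1 (\<lambda>_. c))
      = 0\<^sub>v (m + 1)"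
  shows "a = (- (1 / c)) \<cdot>\<^sub>v (M *\<^sub>v v)" "d = - (1 / c) * (b \<bullet> v)"
proof -
  have "four_block_mat M (mat_of_col a) (mat_of_row b) (mat_of_scalar d) *\<^sub>v (v @\<^sub>v vec 1 (\<lambda>_. c))
      = (M *\<^sub>v v + c \<cdot>\<^sub>v a) @\<^sub>v vec 1 (\<lambda>_. b \<bullet> v + d * c)"
    (is "?l = ?r")
  proof -
    have "vec 1 (\<lambda>_. b \<bullet> v) + vec 1 (\<lambda>_. d * c) = vec 1 (\<lambda>_. b \<bullet> v + d * c)"
      by (rule eq_vecI) auto
    moreover have "?l = (M *\<^sub>v v + mat_of_col a *\<^sub>v vec 1 (\<lambda>_. c)) @\<^sub>v
        (mat_of_row b *\<^sub>v v + mat_of_scalar d *\<^sub>v vec 1 (\<lambda>_. c))"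
      using assms(1-4) by (intro four_block_mat_mult_vec) auto
    ultimately show ?thesis
      by (simp only: mat_of_col_mult_vec1 mat_of_row_mult_vec mat_of_scalar_mult_vec1)
  qed
  then have e: "((M *\<^sub>v v + c \<cdot>\<^sub>v a) @\<^sub>v vec 1 (\<lambda>_. b \<bullet> v + d * c)) $ i = 0" if "i < m + 1" for i
    using null that by simp
  show "a = (- (1 / c)) \<cdot>\<^sub>v (M *\<^sub>v v)"
  proof (rule eq_vecI)
    fix i assume "i < dim_vec ((- (1 / c)) \<cdot>\<^sub>v (M *\<^sub>v v))"
    then show "a $ i = ((- (1 / c)) \<cdot>\<^sub>v (M *\<^sub>v v)) $ i"
      using e[of i] M a v c by (simp add: field_simps add_eq_0_iff)
  qed (use M a in auto)
  show "d = - (1 / c) * (b \<bullet> v)"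
    using e[of m] M a c by (simp add: field_simps add_eq_0_iff)
qed

text \<open>
  For c \<noteq> 0, the block matrix on the right is the only bordering of M that annihilates (v, c) from
  both sides; the product on the left does so because perp_rows m v c maps (v, c) to 0.
\<close>

lemma bordered_factorization:
  assumes M: "M \<in> carrier_mat m m" and v: "v \<in> carrier_vec m"
  shows "perp_cols m v c * M * perp_rows m v c =
    four_block_mat M ((- (1 / c)) \<cdot>\<^sub>m (M * mat_of_col v)) ((- (1 / c)) \<cdot>\<^sub>m (mat_of_row v * M))
      ((1 / c\<^sup>2) \<cdot>\<^sub>m (mat_of_row v * M * mat_of_col v))"
proof -
  have 1: "perp_cols m v c * M = M @\<^sub>r (- (1 / c)) \<cdot>\<^sub>m (mat_of_row v * M)"
    using assms by (subst append_rows_mult[of _ m m _ 1]) (auto simp: mult_smult_assoc_mat[of _ 1 m])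
  define N where "N = mat_of_row v * M"
  have N: "N \<in> carrier_mat 1 m" unfolding N_def using assms by auto
  have "(M @\<^sub>r (- (1 / c)) \<cdot>\<^sub>m N) * perp_rows m v c =
      four_block_mat M ((- (1 / c)) \<cdot>\<^sub>m (M * mat_of_col v)) ((- (1 / c)) \<cdot>\<^sub>m N)
        ((- (1 / c)) \<cdot>\<^sub>m ((- (1 / c)) \<cdot>\<^sub>m (N * mat_of_col v)))"
    using M N v
    by (subst append_rows_mult_append_cols[of _ m m _ 1 _ m _ 1])
      (auto simp: mult_smult_assoc_mat[of _ 1 m _ 1] mult_smult_distrib[of _ m m _ 1]
        mult_smult_distrib[of _ 1 m _ 1])
  moreover have "(- (1 / c)) \<cdot>\<^sub>m ((- (1 / c)) \<cdot>\<^sub>m (N * mat_of_col v)) = (1 / c\<^sup>2) \<cdot>\<^sub>m (N * mat_of_col v)"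
    by (rule eq_matI) (auto simp: power2_eq_square)
  ultimately show ?thesis by (simp add: 1 N_def)
qed

lemma perp_rows_mult_perp_cols:
  fixes B :: "real mat"
  assumes "B \<in> carrier_mat m m" "b \<in> carrier_vec m" "d \<in> carrier_vec m" "v \<in> carrier_vec m"
  shows "perp_rows m v c * four_block_mat B (mat_of_col b) (mat_of_row d) (mat_of_scalar e) *
      perp_cols m v c =
    B - (1 / c) \<cdot>\<^sub>m outer v d - (1 / c) \<cdot>\<^sub>m outer b v + (e / c\<^sup>2) \<cdot>\<^sub>m outer v v"
proof -
  let ?k = "- (1 / c)"
  have F: "four_block_mat B (mat_of_col b) (mat_of_row d) (mat_of_scalar e) \<in> carrier_mat (m + 1) (m + 1)"
    using assms by (intro four_block_carrier_mat) auto
  have R: "perp_rows m v c \<in> carrier_mat m (m + 1)" and P: "perp_cols m v c \<in> carrier_mat (m + 1) m"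
    using assms by (auto simp del: One_nat_def)
  have 1: "four_block_mat B (mat_of_col b) (mat_of_row d) (mat_of_scalar e) * perp_cols m v c =
      (B + ?k \<cdot>\<^sub>m outer b v) @\<^sub>r mat_of_row (d + (?k * e) \<cdot>\<^sub>v v)"
  proof -
    have "mat_of_row d + ?k \<cdot>\<^sub>m (mat_of_scalar e * mat_of_row v) = mat_of_row (d + (?k * e) \<cdot>\<^sub>v v)"
      using assms by (intro eq_matI) (auto simp: mat_of_scalar_def scalar_prod_def)
    then show ?thesis
      using assms
      by (subst four_block_mat_mult_append_rows[of _ m m _ 1 _ 1])
        (auto simp: mult_smult_distrib[of _ m 1 _ m] mult_smult_distrib[of _ 1 1 _ m])
  qed
  have "perp_rows m v c * four_block_mat B (mat_of_col b) (mat_of_row d) (mat_of_scalar e) *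
      perp_cols m v c = perp_rows m v c * ((B + ?k \<cdot>\<^sub>m outer b v) @\<^sub>r mat_of_row (d + (?k * e) \<cdot>\<^sub>v v))"
    using assoc_mult_mat[OF R F P] 1 by simp
  also have "\<dots> = (B + ?k \<cdot>\<^sub>m outer b v) + outer (?k \<cdot>\<^sub>v v) (d + (?k * e) \<cdot>\<^sub>v v)"
    using assms by (subst append_cols_mult_append_rows[of _ m m _ 1]) (auto simp: smult_mat_of_col)
  also have "\<dots> = B - (1 / c) \<cdot>\<^sub>m outer v d - (1 / c) \<cdot>\<^sub>m outer b v + (e / c\<^sup>2) \<cdot>\<^sub>m outer v v"
    using assms by (intro eq_matI) (auto simp: algebra_simps power2_eq_square)
  finally show ?thesis .
qed

section \<open>Recovering the pseudo-inverse from the inverse of the leading block\<close>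

lemma index_append_vec1:
  assumes "v \<in> carrier_vec m" "i < m + 1"
  shows "(v @\<^sub>v vec 1 (\<lambda>_. c)) $ i = (if i < m then v $ i else c)"
  using assms by simp

text \<open>
  In the following lemmas the matrices [I, 0] and its transpose select the leading m coordinates.
  Multiplied by I - u u^T, they give the outer factors in the block formula for the pseudo-inverse.
\<close>

context
  fixes m :: nat and v u :: "real vec" and c :: real
  assumes v: "v \<in> carrier_vec m" and u: "u = v @\<^sub>v vec 1 (\<lambda>_. c)"
begin

lemma bordered_vec_carrier: "u \<in> carrier_vec (m + 1)"
  unfolding u using v by (intro append_carrier_vec) auto

lemma restrict_projector:
  "(1\<^sub>m m @\<^sub>c 0\<^sub>m m 1) * (1\<^sub>m (m + 1) - outer u u) =
    (1\<^sub>m m - outer v v) @\<^sub>c (- c) \<cdot>\<^sub>m mat_of_col v"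
proof -
  let ?E = "1\<^sub>m m @\<^sub>c 0\<^sub>m m 1 :: real mat"
  have E: "?E \<in> carrier_mat m (m + 1)" by (rule append_cols_carrier) auto
  have Eu: "?E *\<^sub>v u = v"
    unfolding u using v by (subst append_cols_mult_vec[of _ m m _ 1]) (auto intro!: eq_vecI)
  have "?E * (1\<^sub>m (m + 1) - outer u u) = ?E * 1\<^sub>m (m + 1) - ?E * outer u u"
    using E bordered_vec_carrier by (intro mult_minus_distrib_mat) auto
  also have "\<dots> = ?E - outer v u"
    by (simp only: right_mult_one_mat[OF E] mult_outer[OF E bordered_vec_carrier bordered_vec_carrier] Eu)
  also have "\<dots> = (1\<^sub>m m - outer v v) @\<^sub>c (- c) \<cdot>\<^sub>m mat_of_col v"
    using v by (intro eq_matI) (auto simp: append_cols_def u)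
  finally show ?thesis .
qed

lemma projector_restrict:
  "(1\<^sub>m (m + 1) - outer u u) * (1\<^sub>m m @\<^sub>r 0\<^sub>m 1 m) =
    (1\<^sub>m m - outer v v) @\<^sub>r (- c) \<cdot>\<^sub>m mat_of_row v"
proof -
  have "transpose_mat ((1\<^sub>m (m + 1) - outer u u) * (1\<^sub>m m @\<^sub>r 0\<^sub>m 1 m)) =
      (1\<^sub>m m @\<^sub>c 0\<^sub>m m 1) * (1\<^sub>m (m + 1) - outer u u)"
    using bordered_vec_carrier
    by (subst transpose_mult[of _ "m + 1" "m + 1" _ m])
      (auto simp: transpose_minus[of _ "m + 1" "m + 1"] transpose_outer
         transpose_append_rows[of _ m m _ 1] simp del: One_nat_def)
  also have "\<dots> = transpose_mat ((1\<^sub>m m - outer v v) @\<^sub>r (- c) \<cdot>\<^sub>m mat_of_row v)"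
    unfolding restrict_projector using v
    by (subst transpose_append_rows[of _ m m _ 1])
      (auto simp: transpose_smult transpose_minus[of _ m m] transpose_outer)
  finally show ?thesis by (simp only: transpose_mat_eq)
qed

text \<open>
  Selecting the leading coordinates and then restoring the last one from orthogonality to u is the
  oblique projector I - e u^T/c, where e is the last unit vector. It fixes every vector orthogonal to u,
  in particular the columns of I - u u^T.
\<close>

lemma perp_cols_restrict_projector:
  assumes c: "c \<noteq> 0" and uu: "u \<bullet> u = 1"
  shows "perp_cols m v c * (1\<^sub>m m @\<^sub>c 0\<^sub>m m 1) * (1\<^sub>m (m + 1) - outer u u) = 1\<^sub>m (m + 1) - outer u u"
proof -
  let ?R = "1\<^sub>m (m + 1) - outer u u" and ?e = "unit_vec (m + 1) m :: real vec"
  have R: "?R \<in> carrier_mat (m + 1) (m + 1)" using bordered_vec_carrier by auto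
  have "perp_cols m v c * (1\<^sub>m m @\<^sub>c 0\<^sub>m m 1) =
      four_block_mat (1\<^sub>m m) (0\<^sub>m m 1) ((- (1 / c)) \<cdot>\<^sub>m mat_of_row v) (0\<^sub>m 1 1)"
    using v by (subst append_rows_mult_append_cols[of _ m m _ 1 _ m _ 1]) auto
  also have "\<dots> = 1\<^sub>m (m + 1) - (1 / c) \<cdot>\<^sub>m outer ?e u"
    using v c by (intro eq_matI) (auto simp: u index_append_vec1)
  finally have 1: "perp_cols m v c * (1\<^sub>m m @\<^sub>c 0\<^sub>m m 1) = 1\<^sub>m (m + 1) - (1 / c) \<cdot>\<^sub>m outer ?e u" .
  have RT: "transpose_mat ?R = ?R"
    using bordered_vec_carrier by (subst transpose_minus[of _ "m + 1" "m + 1"]) (auto simp: transpose_outer)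
  have Ru: "?R *\<^sub>v u = 0\<^sub>v (m + 1)"
    using bordered_vec_carrier uu outer_mult_vec[OF bordered_vec_carrier bordered_vec_carrier bordered_vec_carrier]
    by (simp add: minus_mult_distrib_mat_vec[of _ "m + 1" "m + 1"])
  have "(1\<^sub>m (m + 1) - (1 / c) \<cdot>\<^sub>m outer ?e u) * ?R = 1\<^sub>m (m + 1) * ?R - (1 / c) \<cdot>\<^sub>m outer ?e u * ?R"
    using R bordered_vec_carrier by (intro minus_mult_distrib_mat[of _ "m + 1" "m + 1"]) auto
  also have "(1 / c) \<cdot>\<^sub>m outer ?e u * ?R = (1 / c) \<cdot>\<^sub>m (outer ?e u * ?R)"
    using R bordered_vec_carrier by (intro mult_smult_assoc_mat[of _ "m + 1" "m + 1"]) auto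
  also have "outer ?e u * ?R = outer ?e (0\<^sub>v (m + 1))"
    by (simp only: outer_mult[OF R bordered_vec_carrier unit_vec_carrier] RT Ru)
  also have "\<dots> = 0\<^sub>m (m + 1) (m + 1)"
    by (rule eq_matI) auto
  finally show ?thesis
    unfolding 1 using R by (auto intro!: eq_matI)
qed

lemma projector_restrict_perp_rows:
  assumes c: "c \<noteq> 0" and uu: "u \<bullet> u = 1"
  shows "(1\<^sub>m (m + 1) - outer u u) * ((1\<^sub>m m @\<^sub>r 0\<^sub>m 1 m) * perp_rows m v c) = 1\<^sub>m (m + 1) - outer u u"
proof -
  let ?R = "1\<^sub>m (m + 1) - outer u u"
  have RT: "transpose_mat ?R = ?R"
    using bordered_vec_carrier by (subst transpose_minus[of _ "m + 1" "m + 1"]) (auto simp: transpose_outer)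
  have R: "?R \<in> carrier_mat (m + 1) (m + 1)" using bordered_vec_carrier by auto
  have P: "perp_cols m v c \<in> carrier_mat (m + 1) m" "1\<^sub>m m @\<^sub>c 0\<^sub>m m 1 \<in> carrier_mat m (m + 1)"
    using v by (auto simp del: One_nat_def)
  have "?R * ((1\<^sub>m m @\<^sub>r 0\<^sub>m 1 m) * perp_rows m v c) =
      transpose_mat (perp_cols m v c * (1\<^sub>m m @\<^sub>c 0\<^sub>m m 1) * ?R)"
  proof -
    have "transpose_mat (1\<^sub>m m @\<^sub>c 0\<^sub>m m 1) = (1\<^sub>m m @\<^sub>r 0\<^sub>m 1 m :: real mat)"
      using transpose_append_rows[of "1\<^sub>m m :: real mat" m m "0\<^sub>m 1 m" 1]
      by (metis one_carrier_mat transpose_one transpose_transpose zero_carrier_mat zero_transpose_mat)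
    then show ?thesis
      using transpose_mult[OF mult_carrier_mat[OF P] R] transpose_mult[OF P] RT transpose_perp_cols[OF v]
      by simp
  qed
  then show ?thesis using perp_cols_restrict_projector[OF assms] RT by simp
qed

end

text \<open>
  Everything reduces to the products (I - v v^T) M and M (I - v v^T), which subtract v t^T and w v^T,
  together with v \<bullet> t = v \<bullet> w, since both equal v^T M v.
\<close>

lemma pseudo_inverse_blocks:
  fixes M :: "real mat"
  assumes M: "M \<in> carrier_mat m m" and v: "v \<in> carrier_vec m"
  defines "w \<equiv> M *\<^sub>v v" and "t \<equiv> transpose_mat M *\<^sub>v v"
  shows "((1\<^sub>m m - outer v v) @\<^sub>r (- c) \<cdot>\<^sub>m mat_of_row v) * M * ((1\<^sub>m m - outer v v) @\<^sub>c (- c) \<cdot>\<^sub>m mat_of_col v) =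
    four_block_mat (M - outer v t - outer w v + (v \<bullet> w) \<cdot>\<^sub>m outer v v)
      (mat_of_col ((c * (v \<bullet> w)) \<cdot>\<^sub>v v - c \<cdot>\<^sub>v w))
      (mat_of_row ((c * (v \<bullet> w)) \<cdot>\<^sub>v v - c \<cdot>\<^sub>v t))
      (mat_of_scalar (c\<^sup>2 * (v \<bullet> w)))"
proof -
  let ?X = "1\<^sub>m m - outer v v"
  have w: "w \<in> carrier_vec m" and t: "t \<in> carrier_vec m" using M v by (auto simp: w_def t_def)
  have X: "?X \<in> carrier_mat m m" using v by auto
  have XT: "transpose_mat ?X = ?X"
    using v by (subst transpose_minus[of _ m m]) (auto simp: transpose_outer)
  have Xv: "?X *\<^sub>v x = x - (v \<bullet> x) \<cdot>\<^sub>v v" if "x \<in> carrier_vec m" for x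
    using that v by (subst minus_mult_distrib_mat_vec[of _ m m]) (auto simp: outer_mult_vec[of v m v m])
  have vt: "v \<bullet> t = v \<bullet> w"
    unfolding w_def t_def
    using transpose_vec_mult_scalar[OF M v v] comm_scalar_prod[OF v, of "transpose_mat M *\<^sub>v v"] M v
    by simp
  have XM: "?X * M = M - outer v t"
    using M v by (subst minus_mult_distrib_mat[of _ m m]) (auto simp: outer_mult[OF M v v] t_def)
  have XMc: "?X * M * mat_of_col v = mat_of_col (w - (v \<bullet> w) \<cdot>\<^sub>v v)"
    using mult_mat_of_col[OF mult_carrier_mat[OF X M] v] assoc_mult_mat_vec[OF X M v] Xv[OF w]
    by (simp add: w_def)
  have rM: "mat_of_row v * M = mat_of_row t" using mat_of_row_mult[OF M v] by (simp add: t_def)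
  have rMX: "mat_of_row v * M * ?X = mat_of_row (t - (v \<bullet> w) \<cdot>\<^sub>v v)"
    using mat_of_row_mult[OF X t] XT Xv[OF t] by (simp add: rM vt)
  have XMX: "?X * M * ?X = M - outer v t - outer w v + (v \<bullet> w) \<cdot>\<^sub>m outer v v"
  proof -
    have "?X * M * ?X = M * ?X - outer v t * ?X"
      unfolding XM using M v t by (intro minus_mult_distrib_mat[of _ m m]) auto
    also have "M * ?X = M - outer w v"
      using M v by (subst mult_minus_distrib_mat[of _ m m]) (auto simp: mult_outer[OF M v v] w_def)
    also have "outer v t * ?X = outer v (t - (v \<bullet> w) \<cdot>\<^sub>v v)"
      using outer_mult[OF X t v] XT Xv[OF t] by (simp add: vt)
    finally show ?thesis
      using M v w t by (auto intro!: eq_matI simp: algebra_simps)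
  qed
  have "(?X @\<^sub>r (- c) \<cdot>\<^sub>m mat_of_row v) * M = ?X * M @\<^sub>r (- c) \<cdot>\<^sub>m (mat_of_row v * M)"
    using M v by (subst append_rows_mult[of _ m m _ 1]) (auto simp: mult_smult_assoc_mat[of _ 1 m])
  also have "\<dots> * (?X @\<^sub>c (- c) \<cdot>\<^sub>m mat_of_col v) =
      four_block_mat (?X * M * ?X) ((- c) \<cdot>\<^sub>m (?X * M * mat_of_col v)) ((- c) \<cdot>\<^sub>m (mat_of_row v * M * ?X))
        ((- c) \<cdot>\<^sub>m ((- c) \<cdot>\<^sub>m (mat_of_row v * M * mat_of_col v)))"
    using M v X t
    by (subst append_rows_mult_append_cols[of _ m m _ 1 _ m _ 1])
      (auto simp: rM mult_smult_assoc_mat[of _ 1 m _ m] mult_smult_assoc_mat[of _ 1 m _ 1]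
        mult_smult_distrib[of _ m m _ 1] mult_smult_distrib[of _ 1 m _ 1])
  also have "(- c) \<cdot>\<^sub>m (?X * M * mat_of_col v) = mat_of_col ((c * (v \<bullet> w)) \<cdot>\<^sub>v v - c \<cdot>\<^sub>v w)"
    unfolding XMc smult_mat_of_col using v w by (auto intro!: eq_vecI simp: algebra_simps)
  also have "(- c) \<cdot>\<^sub>m (mat_of_row v * M * ?X) = mat_of_row ((c * (v \<bullet> w)) \<cdot>\<^sub>v v - c \<cdot>\<^sub>v t)"
    unfolding rMX smult_mat_of_row using v t by (auto intro!: eq_vecI simp: algebra_simps)
  also have "(- c) \<cdot>\<^sub>m ((- c) \<cdot>\<^sub>m (mat_of_row v * M * mat_of_col v)) = mat_of_scalar (c\<^sup>2 * (v \<bullet> w))"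
    using row_times_col[OF t v] comm_scalar_prod[OF t v]
    by (simp add: rM smult_mat_of_scalar power2_eq_square vt)
  finally show ?thesis unfolding XMX .
qed

theorem theorem1:
  fixes n :: nat
    and A C B A\<^sub>1\<^sub>1 B\<^sub>1\<^sub>1 :: "real mat"
    and u u\<^sub>1 a\<^sub>1\<^sub>2 a\<^sub>2\<^sub>1 b\<^sub>1\<^sub>2 b\<^sub>2\<^sub>1 :: "real vec"
    and \<alpha> u\<^sub>n a\<^sub>n\<^sub>n b\<^sub>n\<^sub>n :: real
  assumes n: "n \<ge> 2"
    and C: "C \<in> carrier_mat n n" "invertible_mat C"
    and u: "u \<in> carrier_vec n"
    and A: "A = C - \<alpha> \<cdot>\<^sub>m (mat_of_col u * mat_of_row u)"
    and A_singular: "\<not> invertible_mat A"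
    and null: "A *\<^sub>v u = 0\<^sub>v n" "transpose_mat A *\<^sub>v u = 0\<^sub>v n"
    and A_part: "A\<^sub>1\<^sub>1 \<in> carrier_mat (n - 1) (n - 1)"
      "a\<^sub>1\<^sub>2 \<in> carrier_vec (n - 1)" "a\<^sub>2\<^sub>1 \<in> carrier_vec (n - 1)"
      "A = four_block_mat A\<^sub>1\<^sub>1 (mat_of_col a\<^sub>1\<^sub>2) (mat_of_row a\<^sub>2\<^sub>1) (mat_of_scalar a\<^sub>n\<^sub>n)"
    and u_part: "u\<^sub>1 \<in> carrier_vec (n - 1)" "u = u\<^sub>1 @\<^sub>v vec 1 (\<lambda>_. u\<^sub>n)"
    and u_norm: "u \<bullet> u = 1"
    and u_pos: "u\<^sub>n > 0"
    and B: "B = mat_inv C - (1 / \<alpha>) \<cdot>\<^sub>m (mat_of_col u * mat_of_row u)"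
    and B_part: "B\<^sub>1\<^sub>1 \<in> carrier_mat (n - 1) (n - 1)"
      "b\<^sub>1\<^sub>2 \<in> carrier_vec (n - 1)" "b\<^sub>2\<^sub>1 \<in> carrier_vec (n - 1)"
      "B = four_block_mat B\<^sub>1\<^sub>1 (mat_of_col b\<^sub>1\<^sub>2) (mat_of_row b\<^sub>2\<^sub>1) (mat_of_scalar b\<^sub>n\<^sub>n)"
  shows
    \<comment> \<open>(a)\<close>
    "(mat_kernel A = span_vec n {u} \<and> mat_kernel (transpose_mat A) = span_vec n {u} \<and>
      is_moore_penrose_inverse A B \<and> pseudo_inverse A = B) \<and>
    \<comment> \<open>(b)\<close>
     (invertible_mat A\<^sub>1\<^sub>1 \<and>
      mat_inv A\<^sub>1\<^sub>1 =
        (1\<^sub>m (n - 1) @\<^sub>c (- (1 / u\<^sub>n)) \<cdot>\<^sub>m mat_of_col u\<^sub>1) * B *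
        (1\<^sub>m (n - 1) @\<^sub>r (- (1 / u\<^sub>n)) \<cdot>\<^sub>m mat_of_row u\<^sub>1) \<and>
      mat_inv A\<^sub>1\<^sub>1 =
        B\<^sub>1\<^sub>1 - (1 / u\<^sub>n) \<cdot>\<^sub>m (mat_of_col u\<^sub>1 * mat_of_row b\<^sub>2\<^sub>1)
            - (1 / u\<^sub>n) \<cdot>\<^sub>m (mat_of_col b\<^sub>1\<^sub>2 * mat_of_row u\<^sub>1)
            + (b\<^sub>n\<^sub>n / u\<^sub>n\<^sup>2) \<cdot>\<^sub>m (mat_of_col u\<^sub>1 * mat_of_row u\<^sub>1)) \<and>
    \<comment> \<open>(c)\<close>
     (let w = mat_inv A\<^sub>1\<^sub>1 *\<^sub>v u\<^sub>1;
          t = transpose_mat (mat_inv A\<^sub>1\<^sub>1) *\<^sub>v u\<^sub>1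
      in
        A = four_block_mat
              A\<^sub>1\<^sub>1
              ((- (1 / u\<^sub>n)) \<cdot>\<^sub>m (A\<^sub>1\<^sub>1 * mat_of_col u\<^sub>1))
              ((- (1 / u\<^sub>n)) \<cdot>\<^sub>m (mat_of_row u\<^sub>1 * A\<^sub>1\<^sub>1))
              ((1 / u\<^sub>n\<^sup>2) \<cdot>\<^sub>m (mat_of_row u\<^sub>1 * A\<^sub>1\<^sub>1 * mat_of_col u\<^sub>1)) \<and>
        A = (1\<^sub>m (n - 1) @\<^sub>r (- (1 / u\<^sub>n)) \<cdot>\<^sub>m mat_of_row u\<^sub>1) * A\<^sub>1\<^sub>1 *
            (1\<^sub>m (n - 1) @\<^sub>c (- (1 / u\<^sub>n)) \<cdot>\<^sub>m mat_of_col u\<^sub>1) \<and>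
        B = ((1\<^sub>m (n - 1) - mat_of_col u\<^sub>1 * mat_of_row u\<^sub>1) @\<^sub>r (- u\<^sub>n) \<cdot>\<^sub>m mat_of_row u\<^sub>1) *
            mat_inv A\<^sub>1\<^sub>1 *
            ((1\<^sub>m (n - 1) - mat_of_col u\<^sub>1 * mat_of_row u\<^sub>1) @\<^sub>c (- u\<^sub>n) \<cdot>\<^sub>m mat_of_col u\<^sub>1) \<and>
        B\<^sub>1\<^sub>1 = mat_inv A\<^sub>1\<^sub>1
              - mat_of_col u\<^sub>1 * mat_of_row t
              - mat_of_col w * mat_of_row u\<^sub>1
              + (u\<^sub>1 \<bullet> w) \<cdot>\<^sub>m (mat_of_col u\<^sub>1 * mat_of_row u\<^sub>1) \<and>
        b\<^sub>1\<^sub>2 = (u\<^sub>n * (u\<^sub>1 \<bullet> w)) \<cdot>\<^sub>v u\<^sub>1 - u\<^sub>n \<cdot>\<^sub>v w \<and>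
        b\<^sub>2\<^sub>1 = (u\<^sub>n * (u\<^sub>1 \<bullet> w)) \<cdot>\<^sub>v u\<^sub>1 - u\<^sub>n \<cdot>\<^sub>v t \<and>
        b\<^sub>n\<^sub>n = u\<^sub>n\<^sup>2 * (u\<^sub>1 \<bullet> w))"
proof -
  define m where "m = n - 1"
  have nm: "n - 1 = m" "n = m + 1" using n by (auto simp: m_def)
  let ?P = "perp_cols m u\<^sub>1 u\<^sub>n" and ?Q = "perp_rows m u\<^sub>1 u\<^sub>n"
  let ?E = "1\<^sub>m m @\<^sub>c 0\<^sub>m m 1 :: real mat" and ?F = "1\<^sub>m m @\<^sub>r 0\<^sub>m 1 m :: real mat"
  let ?R = "1\<^sub>m n - outer u u"
  define X where "X = mat_inv C"
  note Ap = A_part[unfolded nm(1)] and Bp = B_part[unfolded nm(1)]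
  have u1: "u\<^sub>1 \<in> carrier_vec m" using u_part nm by simp
  have un: "u\<^sub>n \<noteq> 0" using u_pos by simp
  have X: "X \<in> carrier_mat n n" "C * X = 1\<^sub>m n" "X * C = 1\<^sub>m n"
    using mat_inv[OF C] by (auto simp: X_def)
  have O: "outer u u \<in> carrier_mat n n" using u by simp
  have Ac: "A \<in> carrier_mat n n" using C u by (auto simp: A)
  have Bc: "B \<in> carrier_mat n n" using X u by (auto simp: B X_def)
  have \<alpha>: "\<alpha> \<noteq> 0"
  proof
    assume "\<alpha> = 0"
    then have "A = C" unfolding A using C u by (auto intro!: eq_matI)
    then show False using A_singular C by simp
  qed
  have C_eq: "C = A + \<alpha> \<cdot>\<^sub>m outer u u"
    unfolding A using C(1) u by (auto intro!: eq_matI)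
  note defl = deflation_pseudo_inverse[OF Ac X(1) u u_norm \<alpha> null X(2,3)[unfolded C_eq],
      folded B[folded X_def]]
  have mp: "is_moore_penrose_inverse A B"
    using moore_penrose_inverseI_projector[OF Ac Bc u defl(1,2) null(2) defl(4)] .
  have BAT: "transpose_mat B * transpose_mat A = 1\<^sub>m n - outer u u"
    using transpose_mult[OF Ac Bc] u unfolding defl(1)
    by (subst (asm) transpose_minus[of _ n n]) (auto simp: transpose_outer)
  have kernels: "mat_kernel A = span_vec n {u}" "mat_kernel (transpose_mat A) = span_vec n {u}"
    using mat_kernel_eq_span_of_projector[OF Ac Bc u defl(2) null(1)]
      mat_kernel_eq_span_of_projector[OF _ _ u BAT null(2)] Ac Bc by auto
  have a12: "a\<^sub>1\<^sub>2 = (- (1 / u\<^sub>n)) \<cdot>\<^sub>v (A\<^sub>1\<^sub>1 *\<^sub>v u\<^sub>1)" and ann: "a\<^sub>n\<^sub>n = - (1 / u\<^sub>n) * (a\<^sub>2\<^sub>1 \<bullet> u\<^sub>1)"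
    using bordered_blocks_of_null_vector[OF Ap(1-3) u1 un, of a\<^sub>n\<^sub>n] null(1) Ap(4) u_part(2) nm(2) by auto
  \<comment> \<open>The last row of A is the last column of its transpose, so the same lemma determines it.\<close>
  have AT: "transpose_mat A =
      four_block_mat (transpose_mat A\<^sub>1\<^sub>1) (mat_of_col a\<^sub>2\<^sub>1) (mat_of_row a\<^sub>1\<^sub>2) (mat_of_scalar a\<^sub>n\<^sub>n)"
    using Ap by (subst Ap(4), subst transpose_four_block_mat[of _ m m _ 1 _ 1]) auto
  have a21: "a\<^sub>2\<^sub>1 = (- (1 / u\<^sub>n)) \<cdot>\<^sub>v (transpose_mat A\<^sub>1\<^sub>1 *\<^sub>v u\<^sub>1)"
    using bordered_blocks_of_null_vector(1)[OF _ Ap(3,2) u1 un, of "transpose_mat A\<^sub>1\<^sub>1" a\<^sub>n\<^sub>n]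
      null(2) AT Ap(1) u_part(2) nm(2) by auto
  have A_blocks: "A = four_block_mat A\<^sub>1\<^sub>1 ((- (1 / u\<^sub>n)) \<cdot>\<^sub>m (A\<^sub>1\<^sub>1 * mat_of_col u\<^sub>1))
      ((- (1 / u\<^sub>n)) \<cdot>\<^sub>m (mat_of_row u\<^sub>1 * A\<^sub>1\<^sub>1))
      ((1 / u\<^sub>n\<^sup>2) \<cdot>\<^sub>m (mat_of_row u\<^sub>1 * A\<^sub>1\<^sub>1 * mat_of_col u\<^sub>1))"
  proof -
    let ?t = "transpose_mat A\<^sub>1\<^sub>1 *\<^sub>v u\<^sub>1"
    have t: "?t \<in> carrier_vec m" using Ap(1) u1 by simp
    have "a\<^sub>n\<^sub>n = (1 / u\<^sub>n\<^sup>2) * (?t \<bullet> u\<^sub>1)"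
      unfolding ann a21 using t u1 by (simp add: power2_eq_square)
    then show ?thesis
      unfolding mult_mat_of_col[OF Ap(1) u1] mat_of_row_mult[OF Ap(1) u1] row_times_col[OF t u1]
        smult_mat_of_col smult_mat_of_row smult_mat_of_scalar a12[symmetric] a21[symmetric]
      using Ap(4) by simp
  qed
  have A_fact: "A = ?P * A\<^sub>1\<^sub>1 * ?Q"
    using A_blocks bordered_factorization[OF Ap(1) u1] by simp
  have P: "?P \<in> carrier_mat n m" and Q: "?Q \<in> carrier_mat m n"
    and E: "?E \<in> carrier_mat m n" and F: "?F \<in> carrier_mat n m"
    using u1 nm by (auto simp del: One_nat_def)
  have EP: "?E * ?P = 1\<^sub>m m"
    using u1 by (subst append_cols_mult_append_rows[of _ m m _ 1]) auto
  have Qu: "transpose_mat ?P *\<^sub>v u = 0\<^sub>v m"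
    using perp_rows_mult_vec[OF u1 un] transpose_perp_cols[OF u1] u_part(2) by simp
  define Y where "Y = ?Q * B * ?P"
  have Y: "Y \<in> carrier_mat m m" using P Q Bc by (auto simp: Y_def)
  have A11Y: "A\<^sub>1\<^sub>1 * Y = 1\<^sub>m m"
    unfolding Y_def
    by (rule compressed_inverse[OF Ap(1) P Q E Bc u EP Qu A_fact defl(1)])
  have YA11: "Y * A\<^sub>1\<^sub>1 = 1\<^sub>m m"
    using mat_mult_left_right_inverse[OF Ap(1) Y A11Y] .
  have inv: "invertible_mat A\<^sub>1\<^sub>1"
    using A11Y YA11 Ap(1) Y unfolding invertible_mat_def inverts_mat_def by auto
  have Y_eq: "mat_inv A\<^sub>1\<^sub>1 = Y"
  proof -
    note i = mat_inv[OF Ap(1) inv]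
    have "mat_inv A\<^sub>1\<^sub>1 = mat_inv A\<^sub>1\<^sub>1 * (A\<^sub>1\<^sub>1 * Y)" using i(1) A11Y by simp
    also have "\<dots> = Y" using assoc_mult_mat[OF i(1) Ap(1) Y] i(3) Y by simp
    finally show ?thesis .
  qed
  have inv_blocks: "Y = B\<^sub>1\<^sub>1 - (1 / u\<^sub>n) \<cdot>\<^sub>m outer u\<^sub>1 b\<^sub>2\<^sub>1 - (1 / u\<^sub>n) \<cdot>\<^sub>m outer b\<^sub>1\<^sub>2 u\<^sub>1
      + (b\<^sub>n\<^sub>n / u\<^sub>n\<^sup>2) \<cdot>\<^sub>m outer u\<^sub>1 u\<^sub>1"
    unfolding Y_def using perp_rows_mult_perp_cols[OF Bp(1-3) u1] Bp(4) by simp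
  have R: "?R \<in> carrier_mat n n" using u by auto
  have RB: "?R * B = B" and BR: "B * ?R = B"
    using projector_mult_annihilated[OF Bc u defl(4)] mult_projector_annihilated[OF Bc u defl(3)] by auto
  have "?R * ?F * (?Q * B * ?P) * (?E * ?R) = B"
    using expanded_inverse[OF P Q E F Bc R _ _ RB BR]
      projector_restrict_perp_rows[OF u1 u_part(2) un u_norm, folded nm(2)]
      perp_cols_restrict_projector[OF u1 u_part(2) un u_norm, folded nm(2)] by blast
  then have B_fact: "B = ((1\<^sub>m m - outer u\<^sub>1 u\<^sub>1) @\<^sub>r (- u\<^sub>n) \<cdot>\<^sub>m mat_of_row u\<^sub>1) * Y *
      ((1\<^sub>m m - outer u\<^sub>1 u\<^sub>1) @\<^sub>c (- u\<^sub>n) \<cdot>\<^sub>m mat_of_col u\<^sub>1)"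
    unfolding restrict_projector[OF u1 u_part(2), folded nm(2)]
      projector_restrict[OF u1 u_part(2), folded nm(2)] Y_def[symmetric] by simp
  define w where "w = Y *\<^sub>v u\<^sub>1"
  define t where "t = transpose_mat Y *\<^sub>v u\<^sub>1"
  have w: "w \<in> carrier_vec m" and t: "t \<in> carrier_vec m" using Y u1 by (auto simp: w_def t_def)
  let ?B11 = "Y - outer u\<^sub>1 t - outer w u\<^sub>1 + (u\<^sub>1 \<bullet> w) \<cdot>\<^sub>m outer u\<^sub>1 u\<^sub>1"
  let ?b12 = "(u\<^sub>n * (u\<^sub>1 \<bullet> w)) \<cdot>\<^sub>v u\<^sub>1 - u\<^sub>n \<cdot>\<^sub>v w" and ?b21 = "(u\<^sub>n * (u\<^sub>1 \<bullet> w)) \<cdot>\<^sub>v u\<^sub>1 - u\<^sub>n \<cdot>\<^sub>v t"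
  have eq: "four_block_mat B\<^sub>1\<^sub>1 (mat_of_col b\<^sub>1\<^sub>2) (mat_of_row b\<^sub>2\<^sub>1) (mat_of_scalar b\<^sub>n\<^sub>n) =
      four_block_mat ?B11 (mat_of_col ?b12) (mat_of_row ?b21) (mat_of_scalar (u\<^sub>n\<^sup>2 * (u\<^sub>1 \<bullet> w)))"
    using trans[OF trans[OF Bp(4)[symmetric] B_fact]
        pseudo_inverse_blocks[OF Y u1, of u\<^sub>n, folded w_def t_def]] .
  have c: "?B11 \<in> carrier_mat m m" "?b12 \<in> carrier_vec m" "?b21 \<in> carrier_vec m"
    using Y u1 w t by auto
  note inject = four_block_mat_inject[OF Bp(1) mat_of_col_carrier(1)[OF Bp(2)]
      mat_of_row_carrier(1)[OF Bp(3)] mat_of_scalar_carrier(1) c(1) mat_of_col_carrier(1)[OF c(2)]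
      mat_of_row_carrier(1)[OF c(3)] mat_of_scalar_carrier(1) eq]
  have B_blocks: "B\<^sub>1\<^sub>1 = ?B11" "b\<^sub>1\<^sub>2 = ?b12" "b\<^sub>2\<^sub>1 = ?b21" "b\<^sub>n\<^sub>n = u\<^sub>n\<^sup>2 * (u\<^sub>1 \<bullet> w)"
    by (fact inject(1) inject(2)[unfolded mat_of_col_eq_iff] inject(3)[unfolded mat_of_row_eq_iff]
      inject(4)[unfolded mat_of_scalar_eq_iff])+
  show ?thesis
    unfolding Let_def nm(1) Y_eq w_def[symmetric] t_def[symmetric]
    by (intro conjI kernels mp pseudo_inverse_eqI[OF mp] inv Y_def inv_blocks A_blocks A_fact B_fact
        B_blocks)
qed

end
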